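(* Let $q=p^s$ be an odd prime power ($p$ prime, $s\in\mathbb{Z}^+$), let $\mathbb{F}_q$ be the finite field with $q$ elements, and let $\phi$ be the unique quadratic multiplicative character of $\mathbb{F}_q$, extended by $\phi(0)=0$. For a positive integer $k\mid q-1$, let $n=(q-1)/k$ and write $D_k=\{x^k: x\in\mathbb{F}_q^{\times}\}=\{a_1,a_2,\dots,a_n\}$ (the $a_i$ distinct, listed in any order). Define the $n\times n$ matrix over $\mathbb{Z}[t]$ $$A_k(t)=\left[t+\phi(a_i+a_j)+\phi(a_i-a_j)\right]_{1\le i,j\le n}.$$ Define integers $c_k,d_k$ by $$\left|\{\infty\}\cup\{(x,y)\in\mathbb{F}_q\times\mathbb{F}_q:\ y^2=x^k+1\}\right|=q+1-c_k,\qquad \left|\{\infty\}\cup\{(x,y)\in\mathbb{F}_q\times\mathbb{F}_q:\ y^2=x^k-1\}\right|=q+1-d_k.$$ Then: (i) If $q\equiv 1\pmod{2k}$, then $\det A_k(t)=0$. In particular, if $q\equiv 1\pmod 4$, then $\det A_2(t)=0$. (ii) If $q\equiv 3\pmod 4$, then $$\det A_2(t)=\left(\frac{q-1}{2}t-1\right)q^{\frac{q-3}{4}}.$$ (iii) If $q\equiv 1\pmod 4$ and $q\not\equiv 1\pmod{2k}$, then there is an integer $u_k$ such that $$\det A_k(t)=\left(\frac{q-1}{k}t-\frac{1}{k}(c_k+d_k+2)\right)u_k^2.$$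
   Context: Here $\phi(x)=1$ if $x$ is a nonzero square in $\mathbb{F}_q$, $\phi(0)=0$, and $\phi(x)=-1$ otherwise. The values $\phi(\cdot)$ are viewed as integers, so $\det A_k(t)$ is a polynomial in $\mathbb{Z}[t]$ (equivalently, the identities hold for every value of $t$). *)

theory Defs
  imports "Jordan_Normal_Form.Determinant" "HOL-Number_Theory.Cong"
begin

definition quad_char :: "'a :: field \<Rightarrow> int" where
  "quad_char x = (if x = 0 then 0 else if \<exists>y. y \<noteq> 0 \<and> x = y ^ 2 then 1 else - 1)"

definition power_residues :: "nat \<Rightarrow> 'a :: field set" where
  "power_residues k = {x ^ k | x. x \<noteq> 0}"

text \<open>The enumeration \<open>a\<^sub>1, \<dots>, a\<^sub>n\<close> is indexed from \<open>0\<close>, as are the rows and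
  columns of matrices.\<close>

definition enumerates :: "nat \<Rightarrow> (nat \<Rightarrow> 'a) \<Rightarrow> 'a set \<Rightarrow> bool" where
  "enumerates n a D \<longleftrightarrow> bij_betw a {..<n} D"

text \<open>The indeterminate \<open>t\<close> is the polynomial \<open>[:0, 1:]\<close>.\<close>

definition char_matrix :: "nat \<Rightarrow> (nat \<Rightarrow> 'a :: field) \<Rightarrow> int poly mat" where
  "char_matrix n a =
     mat n n (\<lambda>(i, j). [:0, 1:] + [:quad_char (a i + a j):] + [:quad_char (a i - a j):])"

text \<open>\<open>None\<close> is the point at infinity; exactly one such point is counted, for every \<open>k\<close>.\<close>

definition curve_points :: "nat \<Rightarrow> 'a :: field \<Rightarrow> ('a \<times> 'a) option set" where
  "curve_points k b = {None} \<union> Some ` {(x, y). y ^ 2 = x ^ k + b}"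

end

theory Submission
  imports Defs "HOL-Algebra.Multiplicative_Group"
begin

text \<open>If \<open>- 1\<close> is a \<open>k\<close>-th power, the columns of \<open>1\<close> and \<open>- 1\<close> coincide. For \<open>k = 2\<close> and
  \<open>q \<equiv> 3\<close> modulo 4, sums of values of the quadratic character give
  \<open>A A\<^sup>T = q I + (n t\<^sup>2 - 2 t - 2) J\<close>, which determines the determinant up to sign; the sign
  follows from its residue modulo 4 at \<open>t = 0\<close>, where all off-diagonal entries are even. In the
  last case, listing the \<open>k\<close>-th powers as powers of a generator turns the matrix into a symmetric
  circulant of odd order. Its action on functions modulo constants is the sum of the actions on
  odd functions and on even functions modulo constants, and these two are isomorphic; so the
  determinant is the row sum times the square of the determinant on odd functions. Counting
  points on the two curves evaluates the row sum.\<close>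

section \<open>Determinants\<close>

text \<open>The all-ones vector is an eigenvector with value \<open>a + of_nat n * c\<close>, and
  modulo it the matrix acts as the scalar \<open>a\<close>. \<open>P\<close> has this vector as its
  first column and unit vectors elsewhere, so it brings \<open>M\<close> into the triangular form
  \<open>U\<close>.\<close>

lemma det_scalar_plus_constant:
  fixes a c :: "'a :: comm_ring_1"
  assumes "n > 0"
  shows "det (mat n n (\<lambda>(i, j). (if i = j then a else 0) + c)) = (a + of_nat n * c) * a ^ (n - 1)"
proof -
  define M where "M = mat n n (\<lambda>(i, j). (if i = j then a else 0) + c)"
  define P :: "'a mat" where "P = mat n n (\<lambda>(i, j). if j = 0 \<or> i = j then 1 else 0)"
  define U where "U = mat n n (\<lambda>(i, j).
    if j = 0 then if i = 0 then a + of_nat n * c else 0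
    else if i = 0 then c else if i = j then a else 0)"
  have carrier: "M \<in> carrier_mat n n" "P \<in> carrier_mat n n" "U \<in> carrier_mat n n"
    by (auto simp: M_def P_def U_def)
  have "M * P = P * U"
  proof (rule eq_matI)
    fix i j assume "i < dim_row (P * U)" "j < dim_col (P * U)"
    then have ij: "i < n" "j < n" using carrier by auto
    have "(M * P) $$ (i, j) = (\<Sum>l = 0..<n. ((if i = l then a else 0) + c) * (if j = 0 \<or> l = j then 1 else 0))"
      using ij by (simp add: M_def P_def scalar_prod_def)
    also have "\<dots> = (if j = 0 then a + of_nat n * c else (if i = j then a else 0) + c)"
      using ij by (simp add: sum.distrib if_distrib[of "\<lambda>x. _ * x"] cong: if_cong)
    also have "\<dots> = (\<Sum>l = 0..<n. (if l = 0 \<or> i = l then 1 else 0) * U $$ (l, j))"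
    proof -
      have "(\<Sum>l = 0..<n. (if l = 0 \<or> i = l then 1 else 0) * U $$ (l, j)) = (\<Sum>l\<in>{0, i}. U $$ (l, j))"
        using ij by (intro sum.mono_neutral_cong_right) auto
      then show ?thesis using ij by (cases "i = 0") (auto simp: U_def)
    qed
    also have "\<dots> = (P * U) $$ (i, j)"
      using ij carrier(3) by (simp add: P_def scalar_prod_def)
    finally show "(M * P) $$ (i, j) = (P * U) $$ (i, j)" .
  qed (use carrier in auto)
  moreover have "det P = 1"
    by (subst det_lower_triangular[OF _ carrier(2)]) (auto simp: P_def prod_list_diag_prod)
  moreover have "det U = (a + of_nat n * c) * a ^ (n - 1)"
  proof -
    have "det U = (\<Prod>i = 0..<n. U $$ (i, i))"
      using carrier(3) by (subst det_upper_triangular[OF _ carrier(3)])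
        (auto simp: U_def prod_list_diag_prod upper_triangular_def)
    also have "\<dots> = U $$ (0, 0) * (\<Prod>i = Suc 0..<n. U $$ (i, i))"
      using assms by (simp add: prod.atLeast_Suc_lessThan)
    also have "(\<Prod>i = Suc 0..<n. U $$ (i, i)) = (\<Prod>i = Suc 0..<n. a)"
      by (rule prod.cong) (auto simp: U_def)
    finally show ?thesis using assms by (simp add: U_def)
  qed
  ultimately show ?thesis
    using carrier by (metis M_def det_mult mult.commute mult_1)
qed

text \<open>A permutation other than the identity moves some \<open>i\<close>, and then also
  \<open>p i\<close>; its term in the Leibniz expansion therefore contains two even off-diagonal
  factors.\<close>

lemma det_cong_prod_diag_mod_4:
  fixes A :: "int mat"
  assumes A: "A \<in> carrier_mat n n"
    and even: "\<And>i j. i < n \<Longrightarrow> j < n \<Longrightarrow> i \<noteq> j \<Longrightarrow> even (A $$ (i, j))"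
  shows "[det A = (\<Prod>i<n. A $$ (i, i))] (mod 4)"
proof -
  let ?S = "{p. p permutes {0..<n}}"
  let ?t = "\<lambda>p. signof p * (\<Prod>i = 0..<n. A $$ (i, p i)) :: int"
  have "4 dvd ?t p" if p: "p \<in> ?S - {id}" for p
  proof -
    have perm: "p permutes {0..<n}" using p by blast
    obtain i where i: "p i \<noteq> i" using p by (auto simp: fun_eq_iff)
    then have "i < n" using perm permutes_not_in[of p _ i] by fastforce
    moreover have "p i < n" using perm calculation permutes_in_image[of p _ i] by auto
    moreover have "p (p i) \<noteq> p i" using i perm by (auto dest: permutes_inj simp: inj_eq)
    moreover have "p (p i) < n" using perm calculation(2) permutes_in_image[of p _ "p i"] by auto
    ultimately have "2 * 2 dvd A $$ (i, p i) * A $$ (p i, p (p i))"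
      using i by (intro mult_dvd_mono) (simp_all add: even)
    also have "\<dots> = (\<Prod>j\<in>{i, p i}. A $$ (j, p j))" using i by auto
    also have "\<dots> dvd (\<Prod>j = 0..<n. A $$ (j, p j))"
      using \<open>i < n\<close> \<open>p i < n\<close> by (intro prod_dvd_prod_subset) auto
    finally show ?thesis by simp
  qed
  then have "4 dvd (\<Sum>p\<in>?S - {id}. ?t p)" by (rule dvd_sum)
  moreover have "det A = ?t id + (\<Sum>p\<in>?S - {id}. ?t p)"
    unfolding det_def'[OF A]
    by (rule sum.remove) (auto simp: finite_permutations permutes_id)
  moreover have "?t id = (\<Prod>i<n. A $$ (i, i))"
    by (simp add: atLeast0LessThan)
  ultimately show ?thesis by (simp add: cong_iff_dvd_diff)
qed

text \<open>The same permutation acts on rows and on columns, so its sign enters twice. This removes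
  the dependence on the order in which the residues are listed.\<close>

lemma det_reindex:
  assumes "bij_betw e {..<n} {..<n}"
  shows "det (mat n n (\<lambda>(i, j). f (e i) (e j))) = det (mat n n (\<lambda>(i, j). f i j))"
proof -
  define p where "p = (\<lambda>i. if i < n then e i else i)"
  have "bij_betw p {0..<n} {0..<n}"
    using assms by (subst bij_betw_cong[of _ p e]) (auto simp: p_def atLeast0LessThan)
  then have p: "p permutes {0..<n}"
    by (rule bij_imp_permutes) (auto simp: p_def)
  have pn: "p i < n" if "i < n" for i using permutes_in_image[OF p, of i] that by auto
  have 1: "det (mat n n (\<lambda>(i, j). g (p i) j)) = signof p * det (mat n n (\<lambda>(i, j). g i j))" for g :: "nat \<Rightarrow> nat \<Rightarrow> 'a"
  proof -
    have "mat n n (\<lambda>(i, j). g (p i) j) = mat n n (\<lambda>(i, j). mat n n (\<lambda>(i, j). g i j) $$ (p i, j))"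
      using pn by (intro eq_matI) auto
    then show ?thesis using det_permute_rows[OF _ p, of "mat n n (\<lambda>(i, j). g i j)"] by simp
  qed
  have tr: "det (mat n n (\<lambda>(i, j). g j i)) = det (mat n n (\<lambda>(i, j). g i j))" for g :: "nat \<Rightarrow> nat \<Rightarrow> 'a"
  proof -
    have "mat n n (\<lambda>(i, j). g j i) = transpose_mat (mat n n (\<lambda>(i, j). g i j))"
      by (intro eq_matI) auto
    then show ?thesis using det_transpose[of "mat n n (\<lambda>(i, j). g i j)" n] by simp
  qed
  have "det (mat n n (\<lambda>(i, j). f (e i) (e j))) = det (mat n n (\<lambda>(i, j). f (p i) (p j)))"
    by (intro arg_cong[of _ _ det] eq_matI) (auto simp: p_def)
  also have "\<dots> = signof p * det (mat n n (\<lambda>(i, j). f j (p i)))"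
    using 1[of "\<lambda>i j. f i (p j)"] tr[of "\<lambda>i j. f j (p i)"] by simp
  also have "\<dots> = signof p * signof p * det (mat n n (\<lambda>(i, j). f i j))"
    using 1[of "\<lambda>i j. f j i"] tr[of f] by simp
  also have "signof p * signof p = (1 :: 'a)" by (simp add: sign_def)
  finally show ?thesis by simp
qed

section \<open>Symmetric circulants of odd order\<close>

text \<open>Functions on the cyclic group of order \<open>n\<close> are modelled as
  \<open>n\<close>-periodic functions on the integers, which keeps shifts and reflection free of
  reductions. The sorts of the value ring allow the factors 2 and \<open>n\<close> to be
  cancelled.\<close>

locale periodic_functions =
  fixes n :: nat and ty :: "'a :: {idom, ring_char_0} itself"
  assumes pos: "n > 0"
begin

definition periodic :: "(int \<Rightarrow> 'a) \<Rightarrow> bool" where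
  "periodic f \<longleftrightarrow> (\<forall>x. f (x + int n) = f x)"

definition delta :: "int \<Rightarrow> 'a" where
  "delta x = (if int n dvd x then 1 else 0)"

text \<open>With \<open>m = i + 1\<close> this is the indicator of \<open>m\<close> minus that of
  \<open>- m\<close>; the offset lets \<open>i < r\<close> run through
  \<open>m = 1, ..., r\<close>.\<close>

definition odd_delta :: "nat \<Rightarrow> int \<Rightarrow> 'a" where
  "odd_delta i x = delta (x - (int i + 1)) - delta (x + (int i + 1))"

lemma periodic_mult: "periodic f \<Longrightarrow> f (x + int n * int k) = f x"
proof (induction k)
  case (Suc k)
  have "f (x + int n * int (Suc k)) = f ((x + int n * int k) + int n)"
    by (simp add: algebra_simps)
  then show ?case using Suc by (simp add: periodic_def)
qed simp

lemma periodic_mod: "periodic f \<Longrightarrow> f (x mod int n) = f x"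
proof -
  assume f: "periodic f"
  show ?thesis
  proof (cases "x div int n \<ge> 0")
    case True
    then have "x = x mod int n + int n * int (nat (x div int n))" by simp
    then show ?thesis using periodic_mult[OF f] by metis
  next
    case False
    have "x mod int n = x + int n * (- (x div int n))"
      using mult_div_mod_eq[of "int n" x] by (simp add: algebra_simps)
    then have "x mod int n = x + int n * int (nat (- (x div int n)))" using False by simp
    then show ?thesis using periodic_mult[OF f] by metis
  qed
qed

lemma periodic_cong: "periodic f \<Longrightarrow> int n dvd x - y \<Longrightarrow> f x = f y"
  using periodic_mod[of f x] periodic_mod[of f y] by (metis mod_eq_dvd_iff)

lemma sum_mult_delta:
  assumes "periodic f"
  shows "(\<Sum>y<n. f (int y) * delta (int y - a)) = f a"
proof -
  define b where "b = nat (a mod int n)"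
  have b: "b < n" "int b = a mod int n" using pos by (auto simp: b_def nat_less_iff)
  have "(\<Sum>y<n. f (int y) * delta (int y - a)) = (\<Sum>y\<in>{b}. f (int y))"
  proof (rule sum.mono_neutral_cong_right)
    show "\<forall>y\<in>{..<n} - {b}. f (int y) * delta (int y - a) = 0"
    proof
      fix y assume y: "y \<in> {..<n} - {b}"
      have "\<not> int n dvd int y - a"
      proof
        assume "int n dvd int y - a"
        then have "int y mod int n = a mod int n" by (simp add: mod_eq_dvd_iff)
        then show False using y b by simp
      qed
      then show "f (int y) * delta (int y - a) = 0" by (simp add: delta_def)
    qed
    show "f (int y) * delta (int y - a) = f (int y)" if "y \<in> {b}" for y
      using that b by (simp add: delta_def mod_eq_dvd_iff[symmetric])
  qed (use b in auto)
  then show ?thesis using b periodic_mod[OF assms] by simp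
qed

lemma periodic_reflect: "periodic f \<Longrightarrow> periodic (\<lambda>y. f (x - y))"
  unfolding periodic_def
proof (intro allI)
  fix y assume f: "\<forall>x. f (x + int n) = f x"
  show "f (x - (y + int n)) = f (x - y)"
    using f[rule_format, of "x - y - int n"] by (simp add: algebra_simps)
qed

lemma periodic_delta: "periodic delta"
  by (auto simp: periodic_def delta_def)

lemma delta_minus: "delta (- x) = delta x"
  by (simp add: delta_def)

text \<open>Such convolutions are the entries of the circulant times the base change: the shift
  \<open>a = 0\<close> serves the odd columns, the shifts -1 and 1 serve their differences.\<close>

lemma sum_mult_odd_delta:
  assumes "periodic f"
  shows "(\<Sum>y<n. f (x - int y) * odd_delta i (int y + a)) = f (x + a - (int i + 1)) - f (x + a + (int i + 1))"
proof -
  have "odd_delta i (int y + a) = delta (int y - ((int i + 1) - a)) - delta (int y - (- a - (int i + 1)))" for y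
    by (simp add: odd_delta_def algebra_simps)
  then have "(\<Sum>y<n. f (x - int y) * odd_delta i (int y + a)) =
      f (x - ((int i + 1) - a)) - f (x - (- a - (int i + 1)))"
    by (simp only: right_diff_distrib sum_subtractf sum_mult_delta[OF periodic_reflect[OF assms]])
  then show ?thesis by (simp add: algebra_simps)
qed

lemma periodic_odd_delta: "periodic (odd_delta i)"
proof -
  have "delta (x + int n + a) = delta (x + a)" for x a
    by (rule periodic_cong[OF periodic_delta]) simp
  from this[of _ "int i + 1"] this[of _ "- (int i + 1)"] show ?thesis
    unfolding periodic_def odd_delta_def by (simp add: algebra_simps)
qed

lemma odd_delta_minus: "odd_delta i (- x) = - odd_delta i x"
proof -
  have "- x - (int i + 1) = - (x + (int i + 1))" "- x + (int i + 1) = - (x - (int i + 1))"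
    by simp_all
  then show ?thesis unfolding odd_delta_def by (simp only: delta_minus) simp
qed

text \<open>Among the representatives \<open>0, ..., 2 * r\<close>, oddness settles 0, the
  assumption covers \<open>1, ..., r\<close>, and the map from \<open>y\<close> to
  \<open>n - y\<close> carries the rest to these.\<close>

lemma odd_periodic_eq_0:
  assumes f: "periodic f" "\<And>x. f (- x) = - f x" and n: "n = 2 * r + 1"
    and 0: "\<And>i. i < r \<Longrightarrow> f (int i + 1) = 0"
  shows "f x = 0"
proof -
  define y where "y = x mod int n"
  have y: "0 \<le> y" "y < int n" using pos by (auto simp: y_def)
  have "f y = 0"
  proof -
    consider "y = 0" | "0 < y" "y \<le> int r" | "int r < y" using y by linarith
    then show ?thesis
    proof cases
      case 1
      have "2 * f 0 = 0" using f(2)[of 0] by simp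
      then show ?thesis using 1 by simp
    next
      case 2
      then show ?thesis using 0[of "nat (y - 1)"] by (simp add: nat_less_iff)
    next
      case 3
      have "f y = - f (int n - y)"
        using f(2)[of "y"] periodic_cong[OF f(1), of "int n - y" "- y"] by simp
      also have "f (int n - y) = 0"
        using 3 y n 0[of "nat (int n - y - 1)"] by (simp add: nat_less_iff algebra_simps)
      finally show ?thesis by simp
    qed
  qed
  then show ?thesis unfolding y_def periodic_mod[OF f(1)] .
qed

lemma odd_delta_eq:
  assumes n: "n = 2 * r + 1" and "i < r" "j < r"
  shows "odd_delta i (int j + 1) = (if i = j then 1 else 0)"
proof -
  \<comment> \<open>The number \<open>i + j + 2\<close> lies strictly between 0 and
    \<open>n\<close>, so the second delta vanishes.\<close>
  have "\<not> int n dvd int j + 1 + (int i + 1)"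
    using assms by (intro zdvd_not_zless) auto
  moreover have "int n dvd int j + 1 - (int i + 1) \<longleftrightarrow> i = j"
  proof
    assume *: "int n dvd int j + 1 - (int i + 1)"
    have "\<bar>int j + 1 - (int i + 1)\<bar> < int n" using assms by auto
    then show "i = j" using dvd_imp_le_int[OF _ *] by force
  qed auto
  ultimately show ?thesis by (simp add: odd_delta_def delta_def)
qed

text \<open>Both sides are odd and periodic and agree at \<open>1, ..., r\<close>, where the
  \<open>odd_delta i\<close> are dual to evaluation.\<close>

lemma odd_periodic_expansion:
  assumes f: "periodic f" "\<And>x. f (- x) = - f x" and n: "n = 2 * r + 1"
  shows "f x = (\<Sum>i<r. f (int i + 1) * odd_delta i x)"
proof -
  let ?h = "\<lambda>x. f x - (\<Sum>i<r. f (int i + 1) * odd_delta i x)"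
  have "?h x = 0"
  proof (rule odd_periodic_eq_0[OF _ _ n])
    show "periodic ?h"
      using f(1) periodic_odd_delta by (simp add: periodic_def)
    show "?h (- x) = - ?h x" for x
      by (simp add: f(2) odd_delta_minus sum_negf)
    show "?h (int i + 1) = 0" if "i < r" for i
      using that by (simp add: odd_delta_eq[OF n] if_distrib[of "\<lambda>x. _ * x"] cong: if_cong)
  qed
  then show ?thesis by simp
qed

end

text \<open>The split \<open>1 + r + r\<close> mirrors the three kinds of columns in the base change
  below.\<close>

lemma sum_lessThan_one_plus:
  "(\<Sum>l<Suc (r + r). f l) = f 0 + (\<Sum>l<r. f (Suc l)) + (\<Sum>l<r. f (Suc (r + l)))"
  for f :: "nat \<Rightarrow> 'a :: comm_monoid_add"
proof -
  have "(\<Sum>l<r + r. f (Suc l)) = (\<Sum>l<r. f (Suc l)) + (\<Sum>l<r. f (Suc (r + l)))"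
    using sum.atLeastLessThan_concat[of 0 r "r + r" "\<lambda>l. f (Suc l)"]
      sum.shift_bounds_nat_ivl[of "\<lambda>l. f (Suc l)" 0 r r]
    by (simp add: atLeast0LessThan add.commute)
  then show ?thesis by (simp add: sum.lessThan_Suc_shift add.assoc del: sum.lessThan_Suc)
qed

text \<open>The columns of the base change \<open>P\<close> below are the constant 1, the odd functions
  \<open>e\<^sub>i - e\<^sub>-\<^sub>i\<close>, and the differences \<open>w (x - 1) - w (x + 1)\<close> of these. As \<open>n\<close> is odd, the
  difference operator is injective on odd functions, and it commutes with the circulant; so the
  circulant becomes block diagonal with the same block \<open>N\<close> twice.\<close>

lemma det_symmetric_circulant:
  fixes F :: "int \<Rightarrow> 'a :: {idom, ring_char_0}"
  assumes per: "\<And>x. F (x + int n) = F x" and sym: "\<And>x. F (- x) = F x" and n: "n = 2 * r + 1"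
  shows "det (mat n n (\<lambda>(i, j). F (int i - int j))) =
    (\<Sum>i<n. F (int i)) * (det (mat r r (\<lambda>(i, j). F (int i - int j) - F (int i + int j + 2))))\<^sup>2"
proof -
  interpret periodic_functions n "TYPE('a)" by unfold_locales (simp add: n)
  have F: "periodic F" using per by (simp add: periodic_def)
  define C where "C = mat n n (\<lambda>(i, j). F (int i - int j))"
  define N where "N = mat r r (\<lambda>(i, j). F (int i - int j) - F (int i + int j + 2))"
  define lam where "lam = (\<Sum>i<n. F (int i))"
  define w :: "nat \<Rightarrow> int \<Rightarrow> 'a" where "w j x = 
    (if j = 0 then 1 else if j \<le> r then odd_delta (j - 1) x
     else odd_delta (j - 1 - r) (x - 1) - odd_delta (j - 1 - r) (x + 1))" for j x
  define P where "P = mat n n (\<lambda>(i, j). w j (int i))"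
  define NN where "NN = four_block_mat N (0\<^sub>m r r) (0\<^sub>m r r) N"
  define B where "B = four_block_mat (mat 1 1 (\<lambda>_. lam)) (0\<^sub>m 1 (r + r)) (0\<^sub>m (r + r) 1) NN"
  have carrier: "C \<in> carrier_mat n n" "N \<in> carrier_mat r r" "P \<in> carrier_mat n n"
    "NN \<in> carrier_mat (r + r) (r + r)" "B \<in> carrier_mat n n"
    using n by (auto simp: C_def N_def P_def NN_def B_def)
  have dims: "dim_row N = r" "dim_col N = r" "dim_row NN = r + r" "dim_col NN = r + r"
    using carrier by auto
  have B_entry: "B $$ (0, 0) = lam" "l < r + r \<Longrightarrow> B $$ (Suc l, 0) = 0" "m < r + r \<Longrightarrow> B $$ (0, Suc m) = 0"
    "l < r + r \<Longrightarrow> m < r + r \<Longrightarrow> B $$ (Suc l, Suc m) = NN $$ (l, m)" for l m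
    by (simp_all add: B_def dims)
  have NN_entry: "NN $$ (l, m) = N $$ (l, m)" "NN $$ (l, r + m) = 0" "NN $$ (r + l, m) = 0"
    "NN $$ (r + l, r + m) = N $$ (l, m)" if "l < r" "m < r" for l m
    using that by (simp_all add: NN_def dims)
  have split: "(\<Sum>l<n. f l) = f 0 + (\<Sum>l<r. f (Suc l)) + (\<Sum>l<r. f (Suc (r + l)))"
    for f :: "nat \<Rightarrow> 'a"
    using sum_lessThan_one_plus[of f r] by (simp add: n mult_2)
  have w0: "w 0 x = 1" and w1: "i < r \<Longrightarrow> w (Suc i) x = odd_delta i x"
    and w2: "w (Suc (r + i)) x = odd_delta i (x - 1) - odd_delta i (x + 1)" for i x
    by (auto simp: w_def)

  \<comment> \<open>\<open>G j\<close> is the circulant applied to \<open>odd_delta j\<close>. It is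
    again odd, so its coefficients are its values at \<open>i + 1\<close>, and these form column
    \<open>j\<close> of \<open>N\<close>.\<close>
  define G where "G j x = F (x - (int j + 1)) - F (x + (int j + 1))" for j x
  have G: "G j x = (\<Sum>i<r. odd_delta i x * N $$ (i, j))" if "j < r" for j x
  proof -
    have "F (x + int n + a) = F (x + a)" for x a
      by (rule periodic_cong[OF F]) simp
    from this[of _ "int j + 1"] this[of _ "- (int j + 1)"] have "periodic (G j)"
      unfolding periodic_def G_def by (simp add: algebra_simps)
    moreover have "G j (- x) = - G j x" for x
    proof -
      have "- x - (int j + 1) = - (x + (int j + 1))" "- x + (int j + 1) = - (x - (int j + 1))"
        by simp_all
      then show ?thesis unfolding G_def by (simp only: sym) simp
    qed
    ultimately have "G j x = (\<Sum>i<r. G j (int i + 1) * odd_delta i x)"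
      by (rule odd_periodic_expansion[OF _ _ n])
    also have "\<dots> = (\<Sum>i<r. odd_delta i x * N $$ (i, j))"
      using that by (intro sum.cong) (auto simp: G_def N_def algebra_simps)
    finally show ?thesis .
  qed
  have "C * P = P * B"
  proof (rule eq_matI)
    fix i j assume "i < dim_row (P * B)" "j < dim_col (P * B)"
    then have ij: "i < n" "j < n" using carrier by auto
    have CP: "(C * P) $$ (i, j) = (\<Sum>y<n. F (int i - int y) * w j (int y))"
      using ij by (simp add: C_def P_def scalar_prod_def atLeast0LessThan)
    have "(P * B) $$ (i, j) = (\<Sum>l<n. w l (int i) * B $$ (l, j))"
      using ij carrier(5) by (simp add: P_def scalar_prod_def atLeast0LessThan)
    then have PB: "(P * B) $$ (i, j) = B $$ (0, j) + (\<Sum>l<r. odd_delta l (int i) * B $$ (Suc l, j))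
        + (\<Sum>l<r. (odd_delta l (int i - 1) - odd_delta l (int i + 1)) * B $$ (Suc (r + l), j))"
      by (simp add: split w0 w1 w2)
    consider "j = 0" | j' where "j = Suc j'" "j' < r" | j' where "j = Suc (r + j')" "j' < r"
    proof (cases j)
      case (Suc m)
      then show thesis using that(2)[of m] that(3)[of "m - r"] ij n by (cases "m < r") auto
    qed (use that in auto)
    then show "(C * P) $$ (i, j) = (P * B) $$ (i, j)"
    proof cases
      case 1
      \<comment> \<open>All rows have the same sum, because the map from \<open>y\<close> to
        \<open>i - y\<close> modulo \<open>n\<close> is an involution of the indices.\<close>
      have "(\<Sum>y<n. F (int i - int y)) = (\<Sum>y<n. F (int y))"
      proof (rule sum.reindex_bij_witness[of _ "\<lambda>y. nat ((int i - int y) mod int n)" "\<lambda>y. nat ((int i - int y) mod int n)"])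
        fix y assume "y \<in> {..<n}"
        then show "nat ((int i - int (nat ((int i - int y) mod int n))) mod int n) = y"
          "nat ((int i - int y) mod int n) \<in> {..<n}"
          "F (int (nat ((int i - int y) mod int n))) = F (int i - int y)"
          using pos by (auto simp: mod_simps nat_less_iff periodic_mod[OF F])
      qed (use pos in \<open>auto simp: mod_simps nat_less_iff\<close>)
      then show ?thesis
        unfolding CP PB
        by (simp add: 1 B_entry w0 lam_def)
    next
      case 2
      have "(C * P) $$ (i, j) = G j' (int i)"
        using sum_mult_odd_delta[OF F, of "int i" j' 0] 2 unfolding CP by (simp add: w1 G_def)
      also have "\<dots> = (P * B) $$ (i, j)"
        using 2 unfolding PB by (simp add: G B_entry NN_entry)
      finally show ?thesis .
    next
      case 3
      \<comment> \<open>Convolution commutes with shifts, so a difference of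
        \<open>odd_delta j'\<close> goes to the same difference of \<open>G j'\<close>, again with
        coefficients from \<open>N\<close>.\<close>
      have "(C * P) $$ (i, j) = G j' (int i - 1) - G j' (int i + 1)"
        using sum_mult_odd_delta[OF F, of "int i" j' "- 1"] sum_mult_odd_delta[OF F, of "int i" j' 1] 3
        unfolding CP by (simp add: w2 G_def right_diff_distrib sum_subtractf)
      also have "\<dots> = (P * B) $$ (i, j)"
        using 3 unfolding PB
        by (simp add: G B_entry NN_entry left_diff_distrib sum_subtractf)
      finally show ?thesis .
    qed
  qed (use carrier in auto)
  moreover have "det P \<noteq> 0"
  proof
    assume "det P = 0"
    then obtain v where v: "v \<in> carrier_vec n" "v \<noteq> 0\<^sub>v n" "P *\<^sub>v v = 0\<^sub>v n"
      using det_0_iff_vec_prod_zero[OF carrier(3)] by auto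
    define a where "a x = (\<Sum>l<r. odd_delta l x * v $ Suc l)" for x
    define b where "b x = (\<Sum>l<r. odd_delta l x * v $ Suc (r + l))" for x
    have a: "periodic a" "a (- x) = - a x" and b: "periodic b" "b (- x) = - b x" for x
      using periodic_odd_delta
      by (simp_all add: a_def b_def periodic_def odd_delta_minus sum_negf)
    \<comment> \<open>A kernel vector is a relation between a constant, an odd function
      \<open>a\<close> and a difference of an odd function \<open>b\<close>. It holds at the row
      indices and extends to all integers by periodicity.\<close>
    have v0: "v $ 0 + a x + (b (x - 1) - b (x + 1)) = 0" for x
    proof -
      define y where "y = nat (x mod int n)"
      have y: "y < n" "int n dvd x - int y" using pos by (auto simp: y_def nat_less_iff mod_eq_dvd_iff[symmetric])
      have "0 = (\<Sum>l<n. w l (int y) * v $ l)"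
        using arg_cong[OF v(3), of "\<lambda>u. u $ y"] y(1) v(1)
        by (simp add: P_def scalar_prod_def atLeast0LessThan)
      also have "\<dots> = v $ 0 + a (int y) + (b (int y - 1) - b (int y + 1))"
        by (simp add: split w0 w1 w2 a_def b_def left_diff_distrib sum_subtractf)
      finally have "0 = v $ 0 + a (int y) + (b (int y - 1) - b (int y + 1))" .
      moreover have "a (int y) = a x" "b (int y - 1) = b (x - 1)" "b (int y + 1) = b (x + 1)"
        using y(2) periodic_cong[OF a(1), of x "int y"] periodic_cong[OF b(1), of "x - 1" "int y - 1"]
          periodic_cong[OF b(1), of "x + 1" "int y + 1"] by simp_all
      ultimately show ?thesis by simp
    qed
    \<comment> \<open>The constant and the difference of \<open>b\<close> are even in
      \<open>x\<close>, so comparing \<open>x\<close> with \<open>- x\<close> isolates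
      \<open>2 * a x\<close>.\<close>
    have a0: "a x = 0" for x
    proof -
      have "- x - 1 = - (x + 1)" "- x + 1 = - (x - 1)" by simp_all
      then have "v $ 0 - a x + (- b (x + 1) + b (x - 1)) = 0"
        using v0[of "- x"] unfolding a(2) by (simp only: b(2)) simp
      note 0 = this
      have "2 * a x = (v $ 0 + a x + (b (x - 1) - b (x + 1))) - (v $ 0 - a x + (- b (x + 1) + b (x - 1)))"
        by (simp add: algebra_simps)
      then have "2 * a x = 0" by (simp only: 0 v0) simp
      then show ?thesis by simp
    qed
    have step: "b (x + 2) = b x + v $ 0" for x using v0[of "x + 1"] a0 by (simp add: algebra_simps)
    have b_even: "b (x + 2 * int m) = b x + of_nat m * v $ 0" for x m
    proof (induction m)
      case (Suc m)
      then show ?case using step[of "x + 2 * int m"] by (simp add: algebra_simps)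
    qed simp
    \<comment> \<open>Taking \<open>n\<close> steps of length 2 covers two periods and returns
      \<open>b\<close> to its initial value.\<close>
    have "of_nat n * v $ 0 = 0"
      using b_even[of 0 n] periodic_mult[OF b(1), of 0 2] by (simp add: mult.commute)
    then have v00: "v $ 0 = 0" using pos by simp
    have b0: "b x = 0" for x
    proof (rule odd_periodic_eq_0[OF b n])
      \<comment> \<open>As \<open>2 * (r + 1) = n + 1\<close>, taking \<open>r + 1\<close> steps of
        length 2 amounts to one step of length 1. So \<open>b\<close> is constant on the natural
        numbers, and zero there by oddness.\<close>
      have "b (x + 1) = b x" for x
        using b_even[of x "Suc r"] periodic_cong[OF b(1), of "x + 1 + int n" "x + 1"] n v00
        by (simp add: algebra_simps)
      then have "b (1 + x) = b x" for x by (metis add.commute)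
      then have "b (int m) = b 0" for m by (induction m) simp_all
      from this[of "Suc i" for i] show "b (int i + 1) = 0" for i
        using b(2)[of 0] by (simp add: add.commute)
    qed
    have "v $ Suc i = 0" "v $ Suc (r + i) = 0" if "i < r" for i
      using a0[of "int i + 1"] b0[of "int i + 1"] that
      by (simp_all add: a_def b_def odd_delta_eq[OF n] if_distrib[of "\<lambda>x. x * _"] cong: if_cong)
    note v12 = this
    have "v $ l = 0" if "l < n" for l
    proof (cases l)
      case (Suc m)
      then show ?thesis using v12(1)[of m] v12(2)[of "m - r"] that n by (cases "m < r") auto
    qed (simp add: v00)
    then show False using v(1,2) by (auto simp: vec_eq_iff)
  qed
  \<comment> \<open>From \<open>C * P = P * B\<close> the nonzero factor \<open>det P\<close>
    cancels in the integral domain.\<close>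
  ultimately have "det C = det B"
    using carrier by (metis det_mult mult.commute mult_left_cancel)
  also have "\<dots> = lam * (det N)\<^sup>2"
  proof -
    have "det NN = det N * det N"
      unfolding NN_def using carrier by (subst det_four_block_mat_upper_right_zero) auto
    moreover have "det B = lam * det NN"
      unfolding B_def using carrier
      by (subst det_four_block_mat_upper_right_zero[where n = 1 and m = "r + r"]) (auto simp: det_single)
    ultimately show ?thesis by (simp add: power2_eq_square)
  qed
  finally show ?thesis unfolding C_def N_def lam_def .
qed

section \<open>The quadratic character of a finite field\<close>

text \<open>Wrapping the type into a record imports a generator of the multiplicative group. Some
  positive \<open>d \<le> m\<close> has \<open>g ^ d = 1\<close>, so the first \<open>d\<close>
  powers already exhaust the \<open>m\<close> nonzero elements, which forces \<open>d = m\<close>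
  and injectivity.\<close>

lemma finite_field_primitive_root:
  "\<exists>g :: 'a :: {field, finite}. bij_betw (\<lambda>i. g ^ i) {..<card (UNIV :: 'a set) - 1} (UNIV - {0})"
proof -
  define R :: "'a ring" where "R = \<lparr>carrier = UNIV, mult = (*), one = 1, zero = 0, add = (+)\<rparr>"
  have "\<exists>y. x + y = 0" for x :: 'a
    by (rule exI[of _ "- x"]) simp
  moreover have "\<exists>y. x * y = 1" if "x \<noteq> 0" for x :: 'a
    by (rule exI[of _ "inverse x"]) (use that in simp)
  ultimately have "field R"
    unfolding R_def
    by (unfold_locales; fastforce simp: Units_def algebra_simps eq_neg_iff_add_eq_0)
  then interpret R: field R .
  obtain g where g: "g \<in> carrier (mult_of R)"
      and gen: "carrier (mult_of R) = {g [^]\<^bsub>R\<^esub> i | i :: nat. i \<in> UNIV}"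
    using R.finite_field_mult_group_has_gen by (auto simp: R_def)
  have pow: "g [^]\<^bsub>R\<^esub> i = g ^ i" for i :: nat
    by (induction i) (auto simp: R_def mult.commute nat_pow_def)
  have g0: "g \<noteq> 0" using g by (simp add: R_def)
  have all: "UNIV - {0} = range (\<lambda>i. g ^ i)"
    using gen by (auto simp: R_def pow[unfolded R_def])
  define m where "m = card (UNIV :: 'a set) - 1"
  have card: "card (UNIV - {0 :: 'a}) = m"
    by (simp add: m_def card_Diff_singleton)
  have "m > 0"
    unfolding card[symmetric] by (subst card_gt_0_iff) (use g0 in auto)
  \<comment> \<open>Pigeonhole: there are \<open>m + 1\<close> exponents but only \<open>m\<close>
    nonzero elements.\<close>
  have "\<not> inj_on (\<lambda>i. g ^ i) {..m}"
  proof
    assume "inj_on (\<lambda>i. g ^ i) {..m}"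
    then have "card ((\<lambda>i. g ^ i) ` {..m}) = Suc m" by (simp add: card_image)
    moreover have "card ((\<lambda>i. g ^ i) ` {..m}) \<le> m"
      unfolding card[symmetric] all by (rule card_mono) auto
    ultimately show False by simp
  qed
  then obtain i j where ij: "i < j" "j \<le> m" "g ^ i = g ^ j"
    by (auto simp: inj_on_def) (metis linorder_neqE_nat)
  define d where "d = j - i"
  have "i + d = j" using ij by (simp add: d_def)
  then have "g ^ i * g ^ d = g ^ i" unfolding power_add[symmetric] using ij by simp
  then have d: "g ^ d = 1" "0 < d" "d \<le> m" using ij g0 by (auto simp: d_def)
  have "g ^ l \<in> (\<lambda>i. g ^ i) ` {..<d}" for l
  proof -
    have "g ^ l = g ^ (d * (l div d) + l mod d)" by simp
    also have "\<dots> = g ^ (l mod d)"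
      unfolding power_add power_mult d(1) by simp
    finally show ?thesis using d(2) by auto
  qed
  then have img: "(\<lambda>i. g ^ i) ` {..<d} = UNIV - {0}" unfolding all by auto
  then have "card ((\<lambda>i. g ^ i) ` {..<d}) = m" using card by simp
  then have "m \<le> d" using card_image_le[of "{..<d}" "\<lambda>i. g ^ i"] by simp
  then have "d = m" using d by simp
  then have "bij_betw (\<lambda>i. g ^ i) {..<m} (UNIV - {0})"
    using img card by (auto simp: bij_betw_def intro!: eq_card_imp_inj_on)
  then show ?thesis unfolding m_def by blast
qed

section \<open>Exponents of a primitive root and the quadratic character\<close>

locale odd_finite_field =
  fixes g :: "'a :: {field, finite}" and q :: nat
  assumes primitive: "bij_betw (\<lambda>i. g ^ i) {..<q - 1} (UNIV - {0})"
    and card_field: "card (UNIV :: 'a set) = q"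
    and odd_card: "odd q"
begin

lemma q_gt: "q > 2"
proof -
  have "card {0, 1 :: 'a} \<le> card (UNIV :: 'a set)" by (rule card_mono) auto
  then show ?thesis using card_field odd_card by (cases "q = 2") auto
qed

lemma nonzero_obtain_power:
  assumes "x \<noteq> 0" obtains i where "i < q - 1" "x = g ^ i"
proof -
  have "x \<in> (\<lambda>i. g ^ i) ` {..<q - 1}"
    using primitive assms(1) by (simp add: bij_betw_def)
  then show thesis using that by auto
qed

lemma root_nonzero [simp]: "g \<noteq> 0"
proof
  assume "g = 0"
  moreover have "g ^ 1 \<in> UNIV - {0}"
    by (rule bij_betw_apply[OF primitive]) (use q_gt in simp)
  ultimately show False by simp
qed

lemma power_inj: "g ^ i = g ^ j \<Longrightarrow> i < q - 1 \<Longrightarrow> j < q - 1 \<Longrightarrow> i = j"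
  using primitive unfolding bij_betw_def inj_on_def by blast

text \<open>The assumption on \<open>g\<close> concerns only exponents below \<open>q - 1\<close>.
  Cancelling in \<open>g ^ (q - 1) = g ^ i\<close> with such an \<open>i\<close> gives
  \<open>g ^ (q - 1 - i) = 1\<close>, which injectivity allows only for
  \<open>i = 0\<close>.\<close>

lemma root_power_order: "g ^ (q - 1) = 1"
proof -
  have "g ^ (q - 1) \<noteq> 0" by simp
  then obtain i where i: "i < q - 1" "g ^ (q - 1) = g ^ i" by (rule nonzero_obtain_power)
  have "g ^ i * g ^ (q - 1 - i) = g ^ i * g ^ 0" using i by (simp flip: power_add)
  then have "g ^ (q - 1 - i) = g ^ 0" by simp
  moreover have "0 < q - 1" using q_gt by simp
  ultimately have "i = 0"
    using power_inj[of "q - 1 - i" 0] i(1) by (metis diff_is_0_eq diff_less linorder_not_less neq0_conv)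
  then show ?thesis unfolding i(2) by simp
qed

lemma power_eq_iff_cong: "g ^ i = g ^ j \<longleftrightarrow> [i = j] (mod (q - 1))"
proof -
  have *: "g ^ l = g ^ (l mod (q - 1))" for l
  proof -
    have "g ^ l = g ^ ((q - 1) * (l div (q - 1)) + l mod (q - 1))" by (simp only: mult_div_mod_eq)
    also have "\<dots> = g ^ (l mod (q - 1))"
      unfolding power_add power_mult root_power_order power_one mult_1_left ..
    finally show ?thesis .
  qed
  show ?thesis
    unfolding cong_def
  proof
    assume "g ^ i = g ^ j"
    then have "g ^ (i mod (q - 1)) = g ^ (j mod (q - 1))"
      by (simp only: *[symmetric])
    then show "i mod (q - 1) = j mod (q - 1)" by (rule power_inj) (use q_gt in auto)
  next
    assume "i mod (q - 1) = j mod (q - 1)"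
    then have "g ^ (i mod (q - 1)) = g ^ (j mod (q - 1))" by simp
    then show "g ^ i = g ^ j" by (simp only: *[symmetric])
  qed
qed

text \<open>This power is a square root of 1 different from 1.\<close>

lemma minus_one_power: "g ^ ((q - 1) div 2) = - 1"
proof -
  have e: "2 * ((q - 1) div 2) = q - 1" using odd_card by simp
  have "(g ^ ((q - 1) div 2))\<^sup>2 = 1"
    by (simp only: power_mult[symmetric] mult.commute[of _ 2] e root_power_order)
  moreover have "g ^ ((q - 1) div 2) \<noteq> g ^ 0"
    using power_inj[of "(q - 1) div 2" 0] q_gt e by auto
  ultimately show ?thesis by (simp add: power2_eq_1_iff)
qed

text \<open>Otherwise \<open>- 1 = 1\<close>, but \<open>- 1\<close> is a power of \<open>g\<close>
  whose exponent lies strictly between 0 and \<open>q - 1\<close>.\<close>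

lemma neg_neq_self: "(x :: 'a) \<noteq> 0 \<Longrightarrow> - x \<noteq> x"
proof
  assume "x \<noteq> 0" "- x = x"
  then have "(1 + 1) * x = 0"
    by (simp only: distrib_right mult_1_left neg_eq_iff_add_eq_0)
  then have "1 + 1 = (0 :: 'a)" using \<open>x \<noteq> 0\<close> mult_eq_0_iff[of "1 + 1" x] by blast
  then have "(- 1 :: 'a) = 1" by (simp only: neg_eq_iff_add_eq_0)
  moreover have "g ^ ((q - 1) div 2) \<noteq> g ^ 0"
    using power_inj[of "(q - 1) div 2" 0] q_gt odd_card by (auto elim!: oddE)
  ultimately show False using minus_one_power by simp
qed

text \<open>As \<open>q - 1\<close> is even, the parity of an exponent is determined by the power,
  and the nonzero squares are the even powers.\<close>

lemma quad_char_power: "quad_char (g ^ i) = (- 1) ^ i"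
proof -
  have "(\<exists>y. y \<noteq> 0 \<and> g ^ i = y\<^sup>2) \<longleftrightarrow> even i"
  proof
    assume "\<exists>y. y \<noteq> 0 \<and> g ^ i = y\<^sup>2"
    then obtain y where y: "y \<noteq> 0" "g ^ i = y\<^sup>2" by blast
    from y(1) obtain j where "y = g ^ j" by (rule nonzero_obtain_power)
    then have "[i = j * 2] (mod (q - 1))"
      using y(2) by (simp add: power_eq_iff_cong flip: power_mult)
    then have "[i = j * 2] (mod 2)"
      by (rule cong_dvd_modulus_nat) (use odd_card in simp)
    then show "even i" by (simp add: cong_def even_iff_mod_2_eq_zero)
  next
    assume "even i"
    then obtain j where "i = 2 * j" by blast
    then show "\<exists>y. y \<noteq> 0 \<and> g ^ i = y\<^sup>2"
      by (intro exI[of _ "g ^ j"]) (simp add: mult.commute flip: power_mult)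
  qed
  then show ?thesis by (auto simp: quad_char_def)
qed

lemma quad_char_zero [simp]: "quad_char (0 :: 'a) = 0"
  by (simp add: quad_char_def)

lemma quad_char_mult: "quad_char (x * y :: 'a) = quad_char x * quad_char y"
proof (cases "x = 0 \<or> y = 0")
  case False
  then obtain i j where "x = g ^ i" "y = g ^ j" by (meson nonzero_obtain_power)
  then show ?thesis by (simp only: quad_char_power flip: power_add)
qed auto

lemma quad_char_minus_one: "quad_char (- 1 :: 'a) = (- 1) ^ ((q - 1) div 2)"
  using quad_char_power[of "(q - 1) div 2"] unfolding minus_one_power .

lemma quad_char_one [simp]: "quad_char (1 :: 'a) = 1"
  using quad_char_power[of 0] by simp

lemma quad_char_cases: "x \<noteq> 0 \<Longrightarrow> quad_char x = 1 \<or> quad_char x = - 1"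
  by (simp add: quad_char_def)

lemma quad_char_square: "quad_char x * quad_char x = (if x = 0 then 0 else 1)"
  by (simp add: quad_char_def)

lemma quad_char_inverse: "quad_char (inverse x :: 'a) = quad_char x"
proof (cases "x = 0")
  case False
  then have "quad_char x * quad_char (inverse x) = 1"
    by (simp flip: quad_char_mult)
  then show ?thesis using quad_char_cases[OF False] by auto
qed simp

section \<open>Complete sums of character values\<close>

lemma sum_quad_char: "(\<Sum>x\<in>UNIV. quad_char (x :: 'a)) = 0"
proof -
  \<comment> \<open>Multiplication by the nonsquare \<open>g\<close> permutes the field and flips
    every sign.\<close>
  have "(\<Sum>x\<in>UNIV. quad_char (x :: 'a)) = (\<Sum>x\<in>UNIV. quad_char (g * x))"
    by (rule sum.reindex_bij_witness[of _ "\<lambda>x. g * x" "\<lambda>x. x / g"]) auto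
  also have "\<dots> = - (\<Sum>x\<in>UNIV. quad_char (x :: 'a))"
    using quad_char_power[of 1] by (simp add: quad_char_mult sum_negf)
  finally show ?thesis by simp
qed

lemma sum_quad_char_shift: "(\<Sum>x\<in>UNIV. quad_char (x + b :: 'a)) = 0"
proof -
  have "(\<Sum>x\<in>UNIV. quad_char (x + b)) = (\<Sum>x\<in>UNIV. quad_char (x :: 'a))"
    by (rule sum.reindex_bij_witness[of _ "\<lambda>x. x - b" "\<lambda>x. x + b"]) auto
  then show ?thesis by (simp add: sum_quad_char)
qed

lemma sum_quad_char_shift_mult:
  "(\<Sum>x\<in>UNIV. quad_char (x + a :: 'a) * quad_char (x + b)) = (if a = b then int q - 1 else - 1)"
proof (cases "a = b")
  case True
  have "(\<Sum>x\<in>UNIV. quad_char (x + a :: 'a) * quad_char (x + a)) = (\<Sum>x\<in>UNIV. quad_char x * quad_char (x :: 'a))"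
    by (rule sum.reindex_bij_witness[of _ "\<lambda>x. x - a" "\<lambda>x. x + a"]) auto
  also have "\<dots> = (\<Sum>x\<in>UNIV - {0 :: 'a}. 1)"
    by (rule sum.mono_neutral_cong_right) (auto simp: quad_char_square)
  also have "\<dots> = int q - 1"
    using q_gt by (simp add: card_Diff_singleton card_field of_nat_diff)
  finally show ?thesis using True by simp
next
  case False
  \<comment> \<open>Where \<open>x + b\<close> is nonzero the summand equals \<open>quad_char (1 + (a - b) / (x + b))\<close>,
    and \<open>(a - b) / (x + b)\<close> runs through all nonzero elements.\<close>
  have "(\<Sum>x\<in>UNIV. quad_char (x + a) * quad_char (x + b)) =
        (\<Sum>x\<in>UNIV - {- b}. quad_char (x + a) * quad_char (x + b))"
    by (rule sum.mono_neutral_right) auto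
  also have "\<dots> = (\<Sum>y\<in>UNIV - {0}. quad_char (y + 1 :: 'a))"
  proof (rule sum.reindex_bij_witness[of _ "\<lambda>y. (a - b) / y - b" "\<lambda>x. (a - b) / (x + b)"])
    fix x assume "x \<in> UNIV - {- b}"
    then have x: "x + b \<noteq> 0" by (auto simp: add_eq_0_iff2)
    then show "(a - b) / ((a - b) / (x + b)) - b = x" "(a - b) / (x + b) \<in> UNIV - {0}"
      using False by (auto simp: field_simps)
    have "(a - b) / (x + b) + 1 = (x + a) * inverse (x + b)"
      using x by (simp add: field_simps)
    then show "quad_char ((a - b) / (x + b) + 1) = quad_char (x + a) * quad_char (x + b)"
      by (simp add: quad_char_mult quad_char_inverse)
  qed (use False in auto)
  \<comment> \<open>The full sum vanishes, and the excluded term at \<open>y = 0\<close> is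
    \<open>quad_char 1 = 1\<close>.\<close>
  also have "\<dots> = - 1"
    using sum_quad_char_shift[of 1] by (simp add: sum_diff1)
  finally show ?thesis using False by simp
qed

end

section \<open>The matrices of power residues\<close>

text \<open>The orbits \<open>{x, f x}\<close> partition \<open>S\<close> into pairs.\<close>

lemma even_card_involution:
  assumes "finite S" and "\<And>x. x \<in> S \<Longrightarrow> f x \<in> S" and "\<And>x. x \<in> S \<Longrightarrow> f (f x) = x"
    and "\<And>x. x \<in> S \<Longrightarrow> f x \<noteq> x"
  shows "even (card S)"
proof -
  let ?C = "(\<lambda>x. {x, f x}) ` S"
  have "\<Union>?C = S" using assms(2) by blast
  moreover have "2 * card ?C = card (\<Union>?C)"
  proof (rule card_partition)
    show "card c = 2" if "c \<in> ?C" for c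
      using that assms(4) by fastforce
    show "c1 \<inter> c2 = {}" if "c1 \<in> ?C" "c2 \<in> ?C" "c1 \<noteq> c2" for c1 c2
      using that assms(3) by (auto, (metis insert_iff)+)
  qed (use assms(1) in auto)
  ultimately show ?thesis by (metis dvd_triv_left)
qed

lemma sum_lessThan_periodic:
  fixes f :: "nat \<Rightarrow> 'a :: semiring_1"
  assumes "\<And>i. f (i + n) = f i"
  shows "(\<Sum>i<m * n. f i) = of_nat m * (\<Sum>i<n. f i)"
proof -
  have per: "f (i + l * n) = f i" for i l
  proof (induction l)
    case (Suc l)
    then show ?case using assms[of "i + l * n"] by (simp add: algebra_simps)
  qed simp
  have "(\<Sum>i<m * n. f i) = (\<Sum>l<m. \<Sum>i = l * n..<l * n + n. f i)"
    by (rule sum.nat_group[symmetric])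
  also have "\<dots> = (\<Sum>l<m. \<Sum>i<n. f i)"
  proof (rule sum.cong)
    fix l
    show "(\<Sum>i = l * n..<l * n + n. f i) = (\<Sum>i<n. f i)"
      using sum.shift_bounds_nat_ivl[of f 0 "l * n" n]
      by (simp add: per atLeast0LessThan add.commute)
  qed simp
  finally show ?thesis by simp
qed

lemma sum_pCons: "(\<Sum>x\<in>A. pCons (f x) (p x)) = pCons (\<Sum>x\<in>A. f x) (\<Sum>x\<in>A. p x)"
  by (induction A rule: infinite_finite_induct) auto

lemma enumeratesD:
  assumes "enumerates n a D"
  shows "i < n \<Longrightarrow> a i \<in> D" and "i < n \<Longrightarrow> j < n \<Longrightarrow> a i = a j \<longleftrightarrow> i = j"
    and "x \<in> D \<Longrightarrow> \<exists>i<n. a i = x" and "card D = n" and "(\<Sum>i<n. f (a i)) = (\<Sum>x\<in>D. f x)"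
  using assms bij_betw_same_card[of a "{..<n}" D] sum.reindex_bij_betw[of a "{..<n}" D f]
  by (auto simp: enumerates_def bij_betw_def inj_on_def) (metis imageE lessThan_iff)

lemma char_matrix_eq:
  "char_matrix n a = mat n n (\<lambda>(i, j). [:quad_char (a i + a j) + quad_char (a i - a j), 1:])"
  by (auto simp: char_matrix_def intro!: eq_matI)

section \<open>Power residues as powers of a generator, and the singular case\<close>

context odd_finite_field
begin

lemma power_residues_bij:
  assumes "k > 0" and "q - 1 = k * n"
  shows "bij_betw (\<lambda>i. (g ^ k) ^ i) {..<n} (power_residues k)"
  unfolding bij_betw_def
proof
  show "inj_on (\<lambda>i. (g ^ k) ^ i) {..<n}"
  proof (rule inj_onI)
    fix i j assume "i \<in> {..<n}" "j \<in> {..<n}" "(g ^ k) ^ i = (g ^ k) ^ j"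
    then have "k * i = k * j" using assms by (intro power_inj) (auto simp: power_mult)
    then show "i = j" using assms by simp
  qed
  show "(\<lambda>i. (g ^ k) ^ i) ` {..<n} = power_residues k"
  proof (intro equalityI subsetI)
    fix x assume "x \<in> (\<lambda>i. (g ^ k) ^ i) ` {..<n}"
    then obtain i where "x = (g ^ i) ^ k" by (auto simp: mult.commute simp flip: power_mult)
    then show "x \<in> power_residues k" unfolding power_residues_def by fastforce
  next
    fix x :: 'a assume "x \<in> power_residues k"
    then obtain y where y: "x = y ^ k" "y \<noteq> 0" by (auto simp: power_residues_def)
    then obtain j where "y = g ^ j" by (meson nonzero_obtain_power)
    then have "x = g ^ (k * j)" using y by (simp add: mult.commute flip: power_mult)
    \<comment> \<open>Exponents count modulo \<open>q - 1 = k * n\<close>, and \<open>k * j\<close>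
      reduces there to \<open>k * (j mod n)\<close>.\<close>
    also have "\<dots> = g ^ (k * (j mod n))"
      unfolding power_eq_iff_cong cong_def assms(2) by simp
    finally have "x = (g ^ k) ^ (j mod n)" by (simp add: power_mult)
    moreover have "n > 0" using assms q_gt by (cases "n = 0") auto
    ultimately show "x \<in> (\<lambda>i. (g ^ k) ^ i) ` {..<n}" by auto
  qed
qed

lemma det_char_matrix_eq_0:
  assumes "k > 0" and "2 * k dvd q - 1" and a: "enumerates n a (power_residues k)"
  shows "det (char_matrix n (a :: nat \<Rightarrow> 'a)) = 0"
proof -
  obtain m where m: "q - 1 = 2 * k * m" using assms(2) by blast
  \<comment> \<open>Half of \<open>q - 1\<close> is \<open>k * m\<close>.\<close>
  have minus: "- 1 = (g ^ m) ^ k"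
    using minus_one_power m by (simp add: mult.commute mult.assoc flip: power_mult)
  have "(1 :: 'a) \<in> power_residues k" by (auto simp: power_residues_def intro!: exI[of _ 1])
  then obtain i where i: "i < n" "a i = 1" using enumeratesD(3)[OF a] by blast
  have "(- 1 :: 'a) \<in> power_residues k"
    unfolding minus power_residues_def by simp (metis power_not_zero root_nonzero)
  then obtain j where j: "j < n" "a j = - 1" using enumeratesD(3)[OF a] by blast
  have "i \<noteq> j" using i j neg_neq_self[of 1] by auto
  \<comment> \<open>Replacing 1 by \<open>- 1\<close> swaps the two character terms in every entry
    of the column.\<close>
  moreover have "col (char_matrix n a) i = col (char_matrix n a) j"
    using i j by (auto simp: char_matrix_eq add.commute)
  ultimately show ?thesis
    using i j by (intro det_identical_columns[of _ n i j]) (simp_all add: char_matrix_def)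
qed

lemma power_residues_2: "x \<in> power_residues 2 \<longleftrightarrow> quad_char (x :: 'a) = 1"
  by (auto simp: power_residues_def quad_char_def)

lemma quad_char_neg: "quad_char (- x :: 'a) = quad_char (- 1 :: 'a) * quad_char x"
  using quad_char_mult[of "- 1" x] by simp

lemma quad_char_diff_commute: "quad_char (x - y :: 'a) = quad_char (- 1 :: 'a) * quad_char (y - x)"
  using quad_char_neg[of "y - x"] by simp

section \<open>Sums over the squares when \<open>- 1\<close> is a nonsquare\<close>

context
  assumes q_mod_4: "q mod 4 = 3"
begin

lemma quad_char_minus_one_eq: "quad_char (- 1 :: 'a) = - 1"
proof -
  have "odd ((q - 1) div 2)" using q_mod_4 by presburger
  then show ?thesis by (simp add: quad_char_minus_one)
qed

text \<open>As \<open>- 1\<close> is a nonsquare, the nonzero squares and their negatives partition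
  the nonzero elements.\<close>

lemma sum_residues_symmetric:
  fixes f :: "'a \<Rightarrow> int"
  shows "(\<Sum>x\<in>power_residues 2. f x + f (- x)) = (\<Sum>x\<in>UNIV. f x) - f 0"
proof -
  have inj: "inj_on uminus (power_residues 2 :: 'a set)" by simp
  have "(\<Sum>x\<in>power_residues 2. f x + f (- x)) = (\<Sum>x\<in>power_residues 2. f x) + (\<Sum>x\<in>uminus ` power_residues 2. f x)"
    by (simp add: sum.distrib sum.reindex[OF inj])
  also have "\<dots> = (\<Sum>x\<in>power_residues 2 \<union> uminus ` power_residues 2. f x)"
  proof (rule sum.union_disjoint[symmetric])
    show "power_residues 2 \<inter> uminus ` power_residues 2 = ({} :: 'a set)"
    proof (intro equals0I, elim IntE imageE)
      fix x y :: 'a assume "x \<in> power_residues 2" "x = - y" "y \<in> power_residues 2"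
      then show False using quad_char_neg[of y] by (simp add: power_residues_2 quad_char_minus_one_eq)
    qed
  qed auto
  also have "power_residues 2 \<union> uminus ` power_residues 2 = UNIV - {0 :: 'a}"
  proof (intro equalityI subsetI)
    fix x :: 'a assume "x \<in> UNIV - {0}"
    then consider "quad_char x = 1" | "quad_char (- x) = 1"
      using quad_char_cases[of x] quad_char_neg[of x] quad_char_minus_one_eq by auto
    then show "x \<in> power_residues 2 \<union> uminus ` power_residues 2"
    proof cases
      case 2
      then have "- x \<in> power_residues 2" by (simp add: power_residues_2)
      then have "- (- x) \<in> uminus ` power_residues 2" by (rule imageI)
      then show ?thesis by simp
    qed (simp add: power_residues_2)
  qed (auto simp: power_residues_2)
  finally show ?thesis by (simp add: sum_diff1)
qed

text \<open>The complete sum of \<open>quad_char (x + y)\<close> over \<open>y\<close> is 0, and the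
  omitted term at \<open>y = 0\<close> is \<open>quad_char x = 1\<close>.\<close>

lemma row_sum:
  assumes "x \<in> power_residues 2"
  shows "(\<Sum>y\<in>power_residues 2. quad_char (x + y) + quad_char (x - y :: 'a)) = - 1"
  using sum_residues_symmetric[of "\<lambda>y. quad_char (x + y)"] sum_quad_char_shift[of x] assms
  by (simp add: add.commute power_residues_2)

text \<open>The product expands into \<open>P z + P (- z) + Q z + Q (- z)\<close>, so both parts
  become complete correlations of the character, each reduced by its value 1 at
  \<open>z = 0\<close>.\<close>

lemma row_inner_product:
  assumes "x \<in> power_residues 2" "y \<in> power_residues 2"
  shows "(\<Sum>z\<in>power_residues 2. (quad_char (x + z) + quad_char (x - z)) * (quad_char (y + z) + quad_char (y - z :: 'a))) =
    (if x = y then int q else 0) - 2"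
proof -
  define P where "P z = quad_char (x + z) * quad_char (y + z)" for z
  define Q where "Q z = quad_char (x + z) * quad_char (y - z)" for z
  have one: "quad_char x = 1" "quad_char y = 1" using assms by (auto simp: power_residues_2)
  \<comment> \<open>Hence the two shifts in the correlation \<open>Q\<close> are always
    distinct.\<close>
  have "y \<noteq> - x"
    using one quad_char_neg[of x] by (auto simp: quad_char_minus_one_eq)
  have "(\<Sum>z\<in>UNIV. P z) = (if x = y then int q - 1 else - 1)"
    using sum_quad_char_shift_mult[of x y] by (simp add: P_def add.commute)
  moreover have "Q z = - (quad_char (z + x) * quad_char (z + (- y)))" for z
    using quad_char_diff_commute[of y z] by (simp add: Q_def add.commute quad_char_minus_one_eq)
  then have "(\<Sum>z\<in>UNIV. Q z) = 1"
    using sum_quad_char_shift_mult[of x "- y"] \<open>y \<noteq> - x\<close> by (simp add: sum_negf) (metis minus_minus)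
  moreover have "(\<Sum>z\<in>power_residues 2. (quad_char (x + z) + quad_char (x - z)) * (quad_char (y + z) + quad_char (y - z)))
     = (\<Sum>z\<in>power_residues 2. P z + P (- z)) + (\<Sum>z\<in>power_residues 2. Q z + Q (- z))"
    by (simp add: P_def Q_def algebra_simps flip: sum.distrib)
  moreover have "P 0 = 1" "Q 0 = 1" by (simp_all add: P_def Q_def one)
  ultimately show ?thesis by (simp add: sum_residues_symmetric)
qed

text \<open>Modulo 4 the determinant at \<open>t = 0\<close> is \<open>quad_char 2\<close>, so this lemma, a form of the second
  supplement to quadratic reciprocity, is what fixes the sign of the determinant.\<close>

lemma quad_char_2_cong: "[quad_char (2 :: 'a) = - int (card (power_residues 2 :: 'a set))] (mod 4)"
proof -
  \<comment> \<open>Inversion acts on the squares; removing 1 leaves no fixed point, because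
    \<open>- 1\<close> is a nonsquare.\<close>
  define S where "S = power_residues 2 - {1 :: 'a}"
  define f where "f x = quad_char (1 + x) + quad_char (1 - x :: 'a)" for x
  have S: "x \<noteq> 0 \<and> x \<noteq> 1 \<and> x \<noteq> - 1 \<and> quad_char x = 1" if "x \<in> S" for x
    using that by (auto simp: S_def power_residues_2 quad_char_minus_one_eq)
  have inverse: "inverse x \<in> S" if "x \<in> S" for x
    using that by (auto simp: S_def power_residues_2 quad_char_inverse)
  \<comment> \<open>Inverting a square \<open>x\<close> keeps \<open>quad_char (1 + x)\<close> and
    negates \<open>quad_char (1 - x)\<close>, so the latter terms cancel in pairs.\<close>
  have pair: "quad_char (1 + inverse x) = quad_char (1 + x)" "f x + f (inverse x) = 2 * quad_char (1 + x)"
    if "x \<in> S" for x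
  proof -
    have x: "x \<noteq> 0" "quad_char x = 1" using S[OF that] by auto
    have eqs: "1 + inverse x = inverse x * (1 + x)" "1 - inverse x = inverse x * (x - 1)"
      using x by (simp_all add: algebra_simps)
    show 1: "quad_char (1 + inverse x) = quad_char (1 + x)"
      unfolding eqs by (simp add: quad_char_mult quad_char_inverse x)
    have "quad_char (1 - inverse x) = quad_char (x - 1)"
      unfolding eqs by (simp add: quad_char_mult quad_char_inverse x)
    then show "f x + f (inverse x) = 2 * quad_char (1 + x)"
      using 1 quad_char_diff_commute[of x 1] by (simp add: f_def quad_char_minus_one_eq)
  qed
  have "1 \<in> (power_residues 2 :: 'a set)" by (simp add: power_residues_2)
  \<comment> \<open>The term removed from the row sum of 1 is
    \<open>f 1 = quad_char 2 + quad_char 0\<close>.\<close>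
  then have "(\<Sum>x\<in>S. f x) = - 1 - quad_char (2 :: 'a)"
    using row_sum[of 1] by (simp add: S_def f_def sum_diff1)
  moreover have "(\<Sum>x\<in>S. f (inverse x)) = (\<Sum>x\<in>S. f x)"
    by (rule sum.reindex_bij_witness[of _ inverse inverse]) (use inverse in auto)
  then have "2 * (\<Sum>x\<in>S. f x) = (\<Sum>x\<in>S. f x + f (inverse x))"
    by (simp add: sum.distrib)
  then have "(\<Sum>x\<in>S. f x) = (\<Sum>x\<in>S. quad_char (1 + x))"
    by (simp add: pair flip: sum_distrib_left)
  moreover obtain m where "card {x \<in> S. quad_char (1 + x) = - 1} = 2 * m"
  proof (rule evenE)
    show "even (card {x \<in> S. quad_char (1 + x) = - 1})"
    proof (rule even_card_involution[where f = inverse])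
      fix x assume x: "x \<in> {x \<in> S. quad_char (1 + x) = - 1}"
      then show "inverse x \<in> {x \<in> S. quad_char (1 + x) = - 1}" by (simp add: inverse pair)
      show "inverse x \<noteq> x"
      proof
        assume "inverse x = x"
        then have "x\<^sup>2 = 1" using S[of x] x by (simp add: power2_eq_square field_simps)
        then show False using S[of x] x by (auto simp: power2_eq_1_iff)
      qed
    qed auto
  qed
  moreover have "(\<Sum>x\<in>S. quad_char (1 + x)) = int (card S) - 2 * int (card {x \<in> S. quad_char (1 + x) = - 1})"
  proof -
    have "quad_char (1 + x) = 1 - 2 * (if quad_char (1 + x) = - 1 then 1 else 0)" if "x \<in> S" for x
      using S[OF that] quad_char_cases[of "1 + x"] by (auto simp: add_eq_0_iff)
    then have "(\<Sum>x\<in>S. quad_char (1 + x)) = (\<Sum>x\<in>S. 1 - 2 * (if quad_char (1 + x) = - 1 then 1 else 0))"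
      by (rule sum.cong[OF refl])
    also have "\<dots> = int (card S) - 2 * (\<Sum>x\<in>S. if quad_char (1 + x) = - 1 then 1 else 0)"
      by (simp only: sum_subtractf flip: sum_distrib_left) simp
    also have "(\<Sum>x\<in>S. if quad_char (1 + x) = - 1 then 1 else 0) = int (card {x \<in> S. quad_char (1 + x) = - 1})"
      by (simp add: sum.If_cases Int_def)
    finally show ?thesis .
  qed
  moreover have "int (card S) = int (card (power_residues 2 :: 'a set)) - 1"
  proof -
    have "card (power_residues 2 :: 'a set) > 0"
      using \<open>1 \<in> (power_residues 2 :: 'a set)\<close> by (auto simp: card_gt_0_iff)
    then show ?thesis using \<open>1 \<in> (power_residues 2 :: 'a set)\<close> by (simp add: S_def of_nat_diff)
  qed
  \<comment> \<open>Two evaluations of the sum of \<open>f\<close> are compared: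
    \<open>- 1 - quad_char 2\<close>, and \<open>card S\<close> minus twice the even number
    \<open>2 * m\<close> of negative signs.\<close>
  ultimately have "quad_char (2 :: 'a) - (- int (card (power_residues 2 :: 'a set))) = 4 * int m"
    by linarith
  then show ?thesis unfolding cong_iff_dvd_diff by simp
qed

end

section \<open>The determinant for squares: absolute value, then sign\<close>

lemma det_char_matrix_2:
  assumes q_mod_4: "q mod 4 = 3" and a: "enumerates ((q - 1) div 2) a (power_residues 2 :: 'a set)"
  shows "det (char_matrix ((q - 1) div 2) a) = [:- 1, int ((q - 1) div 2):] * [:int q ^ ((q - 3) div 4):]"
proof -
  define n where "n = (q - 1) div 2"
  define m where "m = (q - 3) div 4"
  have nm: "n = 2 * m + 1" "q = 2 * n + 1"
    using q_mod_4 unfolding n_def m_def by presburger+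
  define D :: "'a set" where "D = power_residues 2"
  have a: "enumerates n a D" using a by (simp add: n_def D_def)
  define A where "A = char_matrix n a"
  have A: "A \<in> carrier_mat n n" by (simp add: A_def char_matrix_def)
  have aD: "i < n \<Longrightarrow> a i \<in> D" for i by (rule enumeratesD(1)[OF a])

  define f where "f x y = quad_char (x + y) + quad_char (x - y)" for x y :: 'a
  have A_entry: "A $$ (i, j) = [:f (a i) (a j), 1:]" if "i < n" "j < n" for i j
    using that by (simp add: A_def char_matrix_eq f_def)
  \<comment> \<open>The coefficients come from the off-diagonal inner product -2, the two row sums
    -1, and the \<open>n\<close> products of leading coefficients.\<close>
  define c where "c = [:- 2, - 2, int n:]"
  have "A * transpose_mat A = mat n n (\<lambda>(i, j). (if i = j then [:int q:] else 0) + c)"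
  proof (rule eq_matI)
    fix i j assume "i < dim_row (mat n n (\<lambda>(i, j). (if i = j then [:int q:] else 0) + c))"
      "j < dim_col (mat n n (\<lambda>(i, j). (if i = j then [:int q:] else 0) + c))"
    then have ij: "i < n" "j < n" by auto
    have "(A * transpose_mat A) $$ (i, j) = (\<Sum>l<n. [:f (a i) (a l), 1:] * [:f (a j) (a l), 1:])"
      using ij A by (simp add: scalar_prod_def A_entry atLeast0LessThan)
    also have "\<dots> = (\<Sum>y\<in>D. [:f (a i) y, 1:] * [:f (a j) y, 1:])"
      by (rule enumeratesD(5)[OF a])
    also have "\<dots> = (\<Sum>y\<in>D. [:f (a i) y * f (a j) y, f (a i) y + f (a j) y, 1:])"
      by (simp add: add.commute mult.commute)
    also have "\<dots> = [:\<Sum>y\<in>D. f (a i) y * f (a j) y, (\<Sum>y\<in>D. f (a i) y) + (\<Sum>y\<in>D. f (a j) y), int n:]"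
      by (simp add: sum_pCons sum.distrib enumeratesD(4)[OF a] of_nat_poly)
    also have "(\<Sum>y\<in>D. f (a i) y * f (a j) y) = (if i = j then int q else 0) - 2"
      using row_inner_product[OF q_mod_4, of "a i" "a j"] aD ij enumeratesD(2)[OF a]
      by (simp add: D_def f_def)
    also have "(\<Sum>y\<in>D. f (a i) y) = - 1"
      using row_sum[OF q_mod_4, of "a i"] aD ij by (simp add: D_def f_def)
    also have "(\<Sum>y\<in>D. f (a j) y) = - 1"
      using row_sum[OF q_mod_4, of "a j"] aD ij by (simp add: D_def f_def)
    finally show "(A * transpose_mat A) $$ (i, j) = mat n n (\<lambda>(i, j). (if i = j then [:int q:] else 0) + c) $$ (i, j)"
      using ij by (simp add: c_def)
  qed (use A in auto)
  then have "(det A)\<^sup>2 = ([:int q:] + of_nat n * c) * [:int q:] ^ (n - 1)"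
    using det_mult[OF A, of "transpose_mat A"] det_transpose[OF A] A
      det_scalar_plus_constant[of n "[:int q:]" c] nm
    by (simp add: power2_eq_square)
  \<comment> \<open>The square is perfect because \<open>q - 2 * n = 1\<close>.\<close>
  also have "[:int q:] + of_nat n * c = [:- 1, int n:]\<^sup>2"
    by (simp add: c_def nm(2) power2_eq_square of_nat_poly algebra_simps)
  also have "[:int q:] ^ (n - 1) = [:int q ^ m:]\<^sup>2"
    by (simp add: nm(1) poly_const_pow power_mult mult.commute[of 2] flip: power_mult)
  finally have "(det A)\<^sup>2 = ([:- 1, int n:] * [:int q ^ m:])\<^sup>2"
    by (simp only: power_mult_distrib)
  then have "det A = [:- 1, int n:] * [:int q ^ m:] \<or> det A = - ([:- 1, int n:] * [:int q ^ m:])"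
    by (simp only: power2_eq_iff)
  moreover have "det A \<noteq> - ([:- 1, int n:] * [:int q ^ m:])"
  proof
    assume neg: "det A = - ([:- 1, int n:] * [:int q ^ m:])"
    \<comment> \<open>Evaluation at \<open>t = 0\<close>: under the wrong sign the determinant
      becomes \<open>+ q ^ m\<close>.\<close>
    define M where "M = map_mat (\<lambda>p. poly p 0) A"
    have M: "M \<in> carrier_mat n n" using A by (simp add: M_def)
    have M_entry: "M $$ (i, j) = f (a i) (a j)" if "i < n" "j < n" for i j
      using that A by (simp add: M_def A_entry)
    interpret comm_ring_hom "\<lambda>p :: int poly. poly p 0"
      by unfold_locales auto
    have "det M = poly (det A) 0" unfolding M_def by (rule hom_det)
    also have "\<dots> = int q ^ m" by (simp add: neg)
    finally have det_M: "det M = int q ^ m" .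
    have "[det M = (\<Prod>i<n. M $$ (i, i))] (mod 4)"
    proof (rule det_cong_prod_diag_mod_4[OF M])
      fix i j assume ij: "i < n" "j < n" "i \<noteq> j"
      then have "a i \<noteq> a j" using enumeratesD(2)[OF a] by simp
      moreover have "a i \<noteq> - a j"
        using aD[of i] aD[of j] ij quad_char_neg[of "a j"] quad_char_minus_one_eq[OF q_mod_4]
        by (auto simp: D_def power_residues_2)
      ultimately have "a i + a j \<noteq> 0" "a i - a j \<noteq> 0" by (simp_all add: eq_neg_iff_add_eq_0)
      then show "even (M $$ (i, j))"
        using quad_char_cases[of "a i + a j"] quad_char_cases[of "a i - a j"] ij
        by (auto simp: M_entry f_def)
    qed
    \<comment> \<open>The diagonal entry is \<open>quad_char (2 * a i) + quad_char 0\<close>, and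
      \<open>a i\<close> is a square.\<close>
    moreover have "M $$ (i, i) = quad_char (2 :: 'a)" if "i < n" for i
      using that aD[of i] quad_char_mult[of 2 "a i"]
      by (simp add: M_entry f_def D_def power_residues_2 flip: mult_2)
    ultimately have "[int q ^ m = quad_char (2 :: 'a) ^ n] (mod 4)"
      unfolding det_M by simp
    also have "quad_char (2 :: 'a) ^ n = quad_char (2 :: 'a)"
      using nm(1) by (auto simp: quad_char_def)
    also have "[quad_char (2 :: 'a) = - int n] (mod 4)"
      using quad_char_2_cong[OF q_mod_4] enumeratesD(4)[OF a] by (simp add: D_def)
    finally have 1: "[int q ^ m = - int n] (mod 4)" .
    have "[int q = - 1] (mod 4)"
      unfolding cong_iff_dvd_diff using q_mod_4 by presburger
    then have "[int q ^ m = (- 1) ^ m] (mod 4)" by (rule cong_pow)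
    with 1 have "[- int n = (- 1) ^ m] (mod 4)" using cong_sym cong_trans by blast
    then have "4 dvd - int n - (- 1) ^ m" by (simp add: cong_iff_dvd_diff)
    \<comment> \<open>With \<open>n = 2 * m + 1\<close>, the number \<open>- n\<close> is congruent
      to \<open>- ((- 1) ^ m)\<close> modulo 4.\<close>
    then show False unfolding nm(1) by (cases "even m") (simp_all, presburger+)
  qed
  ultimately show ?thesis by (simp add: A_def n_def m_def)
qed

section \<open>Point counts on the two curves\<close>

lemma card_square_roots: "int (card {y :: 'a. y\<^sup>2 = z}) = 1 + quad_char z"
proof -
  consider "z = 0" | y where "z = y\<^sup>2" "y \<noteq> 0" | "z \<noteq> 0" "\<not> (\<exists>y. z = y\<^sup>2)" by fastforce
  then show ?thesis
  proof cases
    case 1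
    then have "{y :: 'a. y\<^sup>2 = z} = {0}" by auto
    then show ?thesis using 1 by simp
  next
    case (2 y)
    then have "{x. x\<^sup>2 = z} = {y, - y}" by (auto simp: power2_eq_iff)
    then show ?thesis using 2 neg_neq_self[of y] by (auto simp: quad_char_def)
  next
    case 3
    then have "{y :: 'a. y\<^sup>2 = z} = {}" by auto
    then show ?thesis using 3 by (auto simp: quad_char_def)
  qed
qed

lemma card_curve_points:
  "int (card (curve_points k (b :: 'a))) = 1 + int q + (\<Sum>x\<in>UNIV. quad_char (x ^ k + b))"
proof -
  have "{(x, y). y\<^sup>2 = x ^ k + b} = (SIGMA x : UNIV. {y. y\<^sup>2 = x ^ k + b})" by auto
  then have "int (card {(x, y). y\<^sup>2 = x ^ k + b}) = (\<Sum>x\<in>UNIV. int (card {y. y\<^sup>2 = x ^ k + b}))"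
    by simp
  also have "\<dots> = int q + (\<Sum>x\<in>UNIV. quad_char (x ^ k + b))"
    by (simp add: card_square_roots sum.distrib card_field)
  finally show ?thesis
    unfolding curve_points_def by (simp add: card_image)
qed

text \<open>The point \<open>x = 0\<close> contributes \<open>quad_char b\<close>. For
  \<open>x = g ^ i\<close> the summand has period \<open>n\<close> in \<open>i\<close>, and the
  nonzero elements cover \<open>k\<close> periods.\<close>

lemma sum_quad_char_power:
  assumes "k > 0" and "q - 1 = k * n"
  shows "(\<Sum>x\<in>UNIV. quad_char (x ^ k + b :: 'a)) = quad_char b + int k * (\<Sum>i<n. quad_char ((g ^ k) ^ i + b))"
proof -
  have "(\<Sum>x\<in>UNIV. quad_char (x ^ k + b)) = quad_char b + (\<Sum>x\<in>UNIV - {0}. quad_char (x ^ k + b))"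
    using assms(1) by (subst sum.remove[of _ 0]) (auto simp: zero_power)
  also have "(\<Sum>x\<in>UNIV - {0}. quad_char (x ^ k + b)) = (\<Sum>i<k * n. quad_char ((g ^ k) ^ i + b))"
    using sum.reindex_bij_betw[OF primitive, of "\<lambda>x. quad_char (x ^ k + b)"]
    unfolding assms(2) by (simp add: mult.commute flip: power_mult)
  also have "\<dots> = int k * (\<Sum>i<n. quad_char ((g ^ k) ^ i + b))"
  proof (rule sum_lessThan_periodic)
    have "(g ^ k) ^ n = 1" using root_power_order assms(2) by (simp add: power_mult)
    then show "quad_char ((g ^ k) ^ (i + n) + b) = quad_char ((g ^ k) ^ i + b)" for i
      by (simp add: power_add)
  qed
  finally show ?thesis .
qed

section \<open>Circulant form for an odd number of residues\<close>

lemma det_char_matrix_eq_square: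
  assumes q: "q mod 4 = 1" "k > 0" "q - 1 = k * n" "odd n"
    and a: "enumerates n a (power_residues k :: 'a set)"
  shows "\<exists>u. det (char_matrix n a) =
    [:\<Sum>i<n. quad_char ((g ^ k) ^ i + 1) + quad_char ((g ^ k) ^ i - 1), int n:] * [:u\<^sup>2:]"
proof -
  define h where "h = g ^ k"
  have h0: "h \<noteq> 0" by (simp add: h_def)
  \<comment> \<open>Integer exponents admit the negative differences \<open>i - j\<close> of
    indices; the relation gives period \<open>n\<close>.\<close>
  have hn: "h powi int n = 1" using root_power_order q(3) by (simp add: h_def flip: power_mult)
  obtain r where n: "n = 2 * r + 1" using \<open>odd n\<close> by (rule oddE)
  have "even ((q - 1) div 2)" using q(1) by presburger
  then have minus_one: "quad_char (- 1 :: 'a) = 1" by (simp add: quad_char_minus_one)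
  have "even k"
  proof -
    have "even (k * n)" unfolding q(3)[symmetric] using odd_card by simp
    then show ?thesis using \<open>odd n\<close> by simp
  qed
  then have "quad_char h = 1" by (simp add: h_def quad_char_power)
  have "quad_char (h ^ i) = 1" for i
    using \<open>even k\<close> quad_char_power[of "k * i"] by (simp add: h_def power_mult)
  then have one: "quad_char (h powi x) = 1" for x
    by (simp add: power_int_def quad_char_inverse power_inverse)

  define f where "f x = quad_char (h powi x + 1) + quad_char (h powi x - 1)" for x
  define F where "F x = [:f x, 1:]" for x
  have f_per: "f (x + int n) = f x" for x
    using h0 hn by (simp add: f_def power_int_add)
  \<comment> \<open>Reversing the exponent multiplies \<open>h powi x + 1\<close> and
    \<open>h powi x - 1\<close> by a residue, up to a sign; both factors have character 1.\<close>
  have f_sym: "f (- x) = f x" for x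
  proof -
    have p: "h powi x * h powi (- x) = 1" using h0 by (simp flip: power_int_add)
    have "h powi (- x) + 1 = h powi (- x) * (h powi x + 1)" "h powi (- x) - 1 = - 1 * (h powi (- x) * (h powi x - 1))"
      using p by (simp_all add: algebra_simps)
    then show ?thesis
      unfolding f_def by (simp only: quad_char_mult one minus_one)
  qed

  have bij: "bij_betw (\<lambda>i. h ^ i) {..<n} (power_residues k)"
    unfolding h_def by (rule power_residues_bij) (use q in auto)
  \<comment> \<open>\<open>e i\<close> is the exponent of \<open>a i\<close> as a power of
    \<open>h\<close>, so \<open>e\<close> permutes the indices.\<close>
  define e where "e = inv_into {..<n} (\<lambda>i. h ^ i) \<circ> a"
  have "bij_betw e {..<n} {..<n}"
    unfolding e_def using a bij_betw_inv_into[OF bij] by (auto simp: enumerates_def intro: bij_betw_trans)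
  have a_eq: "a i = h powi int (e i)" if "i < n" for i
    using bij_betw_inv_into_right[OF bij enumeratesD(1)[OF a that]] by (simp add: e_def)
  have "char_matrix n a = mat n n (\<lambda>(i, j). F (int (e i) - int (e j)))"
  proof (rule eq_matI)
    fix i j assume "i < dim_row (mat n n (\<lambda>(i, j). F (int (e i) - int (e j))))"
      "j < dim_col (mat n n (\<lambda>(i, j). F (int (e i) - int (e j))))"
    then have ij: "i < n" "j < n" by auto
    define d where "d = int (e i) - int (e j)"
    \<comment> \<open>Since \<open>a j\<close> has character 1, factoring it out leaves an entry
      depending only on the difference of exponents.\<close>
    have "a i = a j * h powi d" using ij h0 by (simp add: a_eq d_def power_int_diff)
    then have "a i + a j = a j * (h powi d + 1)" "a i - a j = a j * (h powi d - 1)"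
      by (simp_all add: algebra_simps)
    then have "quad_char (a i + a j) + quad_char (a i - a j) = f d"
      using one[of "int (e j)"] ij unfolding f_def by (simp only: quad_char_mult a_eq)
    then show "char_matrix n a $$ (i, j) = mat n n (\<lambda>(i, j). F (int (e i) - int (e j))) $$ (i, j)"
      using ij by (simp add: char_matrix_eq F_def d_def)
  qed (simp_all add: char_matrix_def)
  then have "det (char_matrix n a) = det (mat n n (\<lambda>(i, j). F (int i - int j)))"
    using det_reindex[OF \<open>bij_betw e {..<n} {..<n}\<close>, of "\<lambda>i j. F (int i - int j)"] by simp
  also have "\<dots> = (\<Sum>i<n. F (int i)) * (det (mat r r (\<lambda>(i, j). F (int i - int j) - F (int i + int j + 2))))\<^sup>2"
    by (rule det_symmetric_circulant[OF _ _ n]) (simp_all add: F_def f_per f_sym)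
  also have "(\<Sum>i<n. F (int i)) = [:\<Sum>i<n. f (int i), int n:]"
    by (simp add: F_def sum_pCons of_nat_poly)
  \<comment> \<open>The variable \<open>t\<close> cancels in each difference of values of
    \<open>F\<close>, so this determinant is an integer constant, the required root.\<close>
  also have "det (mat r r (\<lambda>(i, j). F (int i - int j) - F (int i + int j + 2))) =
      [:det (mat r r (\<lambda>(i, j). f (int i - int j) - f (int i + int j + 2))):]"
  proof -
    interpret comm_ring_hom "\<lambda>x :: int. [:x:]" by unfold_locales auto
    show ?thesis
      unfolding hom_det[symmetric] by (intro arg_cong[of _ _ det] eq_matI) (auto simp: F_def)
  qed
  finally show ?thesis
    unfolding f_def h_def by (intro exI) (simp only: poly_const_pow power_int_of_nat)
qed

end

section \<open>Case distinction on \<open>q\<close> and evaluation of the row sum\<close>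

theorem theorem1p1:
  fixes p s q k :: nat and c d :: int
  assumes "prime p" and "odd p" and "s > 0" and "q = p ^ s"
    and "card (UNIV :: 'a :: {field, finite} set) = q"
    and "k > 0" and "k dvd q - 1"
    and "int (card (curve_points k (1 :: 'a))) = int q + 1 - c"
    and "int (card (curve_points k (- 1 :: 'a))) = int q + 1 - d"
  shows
    "([q = 1] (mod 2 * k) \<longrightarrow>
        (\<forall>a :: nat \<Rightarrow> 'a. enumerates ((q - 1) div k) a (power_residues k) \<longrightarrow>
          det (char_matrix ((q - 1) div k) a) = 0)) \<and>
     ([q = 1] (mod 4) \<longrightarrow>
        (\<forall>a :: nat \<Rightarrow> 'a. enumerates ((q - 1) div 2) a (power_residues 2) \<longrightarrow>
          det (char_matrix ((q - 1) div 2) a) = 0)) \<and>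
     ([q = 3] (mod 4) \<longrightarrow>
        (\<forall>a :: nat \<Rightarrow> 'a. enumerates ((q - 1) div 2) a (power_residues 2) \<longrightarrow>
          det (char_matrix ((q - 1) div 2) a) =
            [:- 1, int ((q - 1) div 2):] * [:int q ^ ((q - 3) div 4):])) \<and>
     ([q = 1] (mod 4) \<and> \<not> [q = 1] (mod 2 * k) \<longrightarrow>
        (\<forall>a :: nat \<Rightarrow> 'a. enumerates ((q - 1) div k) a (power_residues k) \<longrightarrow>
          (\<exists>u :: int.
            map_poly rat_of_int (det (char_matrix ((q - 1) div k) a)) =
              [:- (1 / of_nat k) * of_int (c + d + 2), of_nat (q - 1) / of_nat k:]
                * [:of_int u ^ 2:])))"
proof -
  obtain g :: 'a where g: "bij_betw (\<lambda>i. g ^ i) {..<q - 1} (UNIV - {0})"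
    using finite_field_primitive_root[where 'a = 'a] assms(5) by blast
  interpret odd_finite_field g q
    by unfold_locales (use g assms in auto)
  show ?thesis
  proof (intro conjI impI allI)
    fix a :: "nat \<Rightarrow> 'a"
    assume "[q = 1] (mod 2 * k)" and a: "enumerates ((q - 1) div k) a (power_residues k)"
    from this(1) have "2 * k dvd q - 1" by (rule cong_to_1_nat)
    then show "det (char_matrix ((q - 1) div k) a) = 0"
      by (rule det_char_matrix_eq_0[OF \<open>k > 0\<close> _ a])
  next
    fix a :: "nat \<Rightarrow> 'a"
    assume "[q = 1] (mod 4)" and a: "enumerates ((q - 1) div 2) a (power_residues 2)"
    \<comment> \<open>This is the vanishing criterion with \<open>k = 2\<close>.\<close>
    from this(1) have "2 * 2 dvd q - 1" using cong_to_1_nat[of q 4] by simp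
    then show "det (char_matrix ((q - 1) div 2) a) = 0"
      by (rule det_char_matrix_eq_0[OF _ _ a, rotated]) simp
  next
    fix a :: "nat \<Rightarrow> 'a"
    assume "[q = 3] (mod 4)" and a: "enumerates ((q - 1) div 2) a (power_residues 2)"
    then show "det (char_matrix ((q - 1) div 2) a) = [:- 1, int ((q - 1) div 2):] * [:int q ^ ((q - 3) div 4):]"
      by (intro det_char_matrix_2) (simp_all add: cong_def)
  next
    fix a :: "nat \<Rightarrow> 'a"
    assume q: "[q = 1] (mod 4) \<and> \<not> [q = 1] (mod 2 * k)" and a: "enumerates ((q - 1) div k) a (power_residues k)"
    define n where "n = (q - 1) div k"
    have n: "q - 1 = k * n" using \<open>k dvd q - 1\<close> by (simp add: n_def)
    have q1: "q mod 4 = 1" using q by (simp add: cong_def)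
    have "odd n"
    proof
      assume "even n"
      then have "2 * k dvd q - 1" unfolding n by (auto simp: mult.assoc)
      then have "[q = 1] (mod 2 * k)" using q_gt by (simp add: cong_altdef_nat cong_sym_eq)
      then show False using q by blast
    qed
    define L where "L = (\<Sum>i<n. quad_char ((g ^ k) ^ i + 1) + quad_char ((g ^ k) ^ i - 1))"
    obtain u where u: "det (char_matrix n a) = [:L, int n:] * [:u\<^sup>2:]"
      using det_char_matrix_eq_square[OF q1 \<open>k > 0\<close> n \<open>odd n\<close>] a unfolding L_def n_def by blast
    have "even ((q - 1) div 2)" using q1 by presburger
    then have "quad_char (- 1 :: 'a) = 1" by (simp add: quad_char_minus_one)
    \<comment> \<open>The two counts give \<open>- c\<close> and \<open>- d\<close> as 1 plus
      \<open>k\<close> times a partial row sum; for \<open>d\<close> the summand 1 is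
      \<open>quad_char (- 1)\<close>.\<close>
    then have "int k * L = - (c + d + 2)"
      using assms(8,9) card_curve_points[of k 1] card_curve_points[of k "- 1"]
        sum_quad_char_power[OF \<open>k > 0\<close> n, of 1] sum_quad_char_power[OF \<open>k > 0\<close> n, of "- 1"]
      by (simp add: L_def sum.distrib distrib_left)
    then have "rat_of_nat k * of_int L = - of_int (c + d + 2)"
      by (metis of_int_minus of_int_mult of_int_of_nat_eq)
    then have "rat_of_int L = - (1 / of_nat k) * of_int (c + d + 2)"
      using \<open>k > 0\<close> by (simp add: field_simps)
    moreover have "rat_of_nat n = of_nat (q - 1) / of_nat k"
      unfolding n using \<open>k > 0\<close> by simp
    moreover have "map_poly rat_of_int (det (char_matrix n a)) = [:of_int L, of_nat n:] * [:of_int u ^ 2:]"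
      by (simp add: u map_poly_pCons)
    ultimately show "\<exists>u :: int. map_poly rat_of_int (det (char_matrix ((q - 1) div k) a)) =
        [:- (1 / of_nat k) * of_int (c + d + 2), of_nat (q - 1) / of_nat k:] * [:of_int u ^ 2:]"
      unfolding n_def[symmetric] by auto
  qed
qed

end
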